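(* For any $\eta<0$, $$u=\frac{-4|\eta|\left(1+\frac{3\mathcal{C}\epsilon}{|\eta|\hat A}\cos(ax+b)\right)}{\left(\epsilon\cos(ax+b)+\frac{3\mathcal{C}}{|\eta|\hat A}\right)^2},\qquad v=\frac{\rho a}{\hat A}\,\frac{\epsilon\sin(ax+b)}{\left(\epsilon\cos(ax+b)+\frac{3\mathcal{C}}{|\eta|\hat A}\right)^2}$$ are solutions of the system $$u_t+uu_x+u_{xxx}-vv_x=0,\qquad v_t+u_xv+v_xu+v_{xxx}=0$$ for any set of real parameters $\mathcal{C},\rho$ satisfying $$\rho\ne0,\qquad \delta=\frac32\frac{\mathcal{C}^2}{|\eta|}-\left(\frac{\rho}{12}\right)^2>0,\qquad \mathcal{C}>0 .$$ Here $\epsilon=\pm1$ and $$a=2\sqrt{\tfrac{|\eta|}6},\qquad \hat A=\left(\tfrac{6\delta}{|\eta|}\right)^{1/2},\qquad b=-a^3t+\text{constant}.$$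
   Context: $u,v$ are real-valued functions of $(x,t)$; subscripts denote partial derivatives. The system is the case $\lambda=-1$ of the parametric coupled KdV system $u_t+uu_x+u_{xxx}+\lambda vv_x=0$, $v_t+u_xv+v_xu+v_{xxx}=0$.
   Formalization: The phase is taken as b = +a³t + constant instead of b = −a³t + constant: with the printed sign u, v do not solve the system (e.g. η=−6, C=10, ρ=48, ε=1, constant 0: at x=t=0 the second equation gives −72). *)

theory Defs
  imports "HOL-Analysis.Analysis"
begin

text \<open>
  Solutions are classical ones on the whole \<open>(x, t)\<close>-plane: every partial derivative occurring in
  the system is required to exist everywhere. Functions are curried, with \<open>x\<close> first.

  A pitfall on the sign of time: with \<open>lam = -1\<close> the system is the complex KdV equation
  \<open>w\<^sub>t + w w\<^sub>x + w\<^sub>x\<^sub>x\<^sub>x = 0\<close> for \<open>w = u + \<i> v\<close>, and a periodic wave on zero background with wave number \<open>a\<close>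
  moves to the left. Its phase is therefore \<open>a x + a\<^sup>3 t + const\<close>. The phase \<open>a x - a\<^sup>3 t + const\<close>, which
  is the one printed in the source, does not give solutions of this system.
\<close>

definition coupled_kdv_solution ::
    "real \<Rightarrow> (real \<Rightarrow> real \<Rightarrow> real) \<Rightarrow> (real \<Rightarrow> real \<Rightarrow> real) \<Rightarrow> bool" where
  "coupled_kdv_solution lam u v \<longleftrightarrow>
     (\<exists>u\<^sub>t u\<^sub>x u\<^sub>x\<^sub>x u\<^sub>x\<^sub>x\<^sub>x v\<^sub>t v\<^sub>x v\<^sub>x\<^sub>x v\<^sub>x\<^sub>x\<^sub>x. \<forall>x t.
        ((\<lambda>s. u x s) has_real_derivative u\<^sub>t x t) (at t) \<and>
        ((\<lambda>y. u y t) has_real_derivative u\<^sub>x x t) (at x) \<and>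
        ((\<lambda>y. u\<^sub>x y t) has_real_derivative u\<^sub>x\<^sub>x x t) (at x) \<and>
        ((\<lambda>y. u\<^sub>x\<^sub>x y t) has_real_derivative u\<^sub>x\<^sub>x\<^sub>x x t) (at x) \<and>
        ((\<lambda>s. v x s) has_real_derivative v\<^sub>t x t) (at t) \<and>
        ((\<lambda>y. v y t) has_real_derivative v\<^sub>x x t) (at x) \<and>
        ((\<lambda>y. v\<^sub>x y t) has_real_derivative v\<^sub>x\<^sub>x x t) (at x) \<and>
        ((\<lambda>y. v\<^sub>x\<^sub>x y t) has_real_derivative v\<^sub>x\<^sub>x\<^sub>x x t) (at x) \<and>
        u\<^sub>t x t + u x t * u\<^sub>x x t + u\<^sub>x\<^sub>x\<^sub>x x t + lam * v x t * v\<^sub>x x t = 0 \<and>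
        v\<^sub>t x t + u\<^sub>x x t * v x t + v\<^sub>x x t * u x t + v\<^sub>x\<^sub>x\<^sub>x x t = 0)"

end

theory Submission
  imports Defs
begin

text \<open>
  With \<open>m = \<rho> / (6 a A)\<close> and \<open>k = 3 C / (\<bar>\<eta>\<bar> A)\<close> the hypotheses give \<open>k\<^sup>2 = 1 + m\<^sup>2\<close>, \<open>k > 1\<close> and
  \<open>4 \<bar>\<eta>\<bar> = 6 a\<^sup>2\<close>. So \<open>u = - 6 a\<^sup>2 U(a x + b)\<close> and \<open>v = 6 a\<^sup>2 V(a x + b)\<close> with \<open>U = k W - m\<^sup>2 W\<^sup>2\<close>,
  \<open>V = m \<epsilon> sin W\<^sup>2\<close> and \<open>W = 1 / (\<epsilon> cos + k)\<close>. For such travelling waves, the system is the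
  derivative of \<open>U'' + U = 3 (U\<^sup>2 - V\<^sup>2)\<close>, \<open>V'' + V = 6 U V\<close>, and these equations become
  polynomial identities modulo \<open>\<epsilon> cos W = 1 - k W\<close> and \<open>sin\<^sup>2 W\<^sup>2 = 2 k W - 1 - m\<^sup>2 W\<^sup>2\<close>.
\<close>

text \<open>Since the phase has x-derivative \<open>a\<close> and t-derivative \<open>a ^ 3\<close>,
  every term of the system carries the factor \<open>a ^ 5\<close>. The amplitude
  \<open>6 * a\<^sup>2\<close> balances the quadratic terms against the third derivatives; the
  linear terms of the profile equations cancel the time derivatives.\<close>

lemma coupled_kdv_travelling_wave:
  fixes a c :: real and U U' V V' :: "real \<Rightarrow> real"
  assumes U: "\<And>z. (U has_real_derivative U' z) (at z)"
    and U': "\<And>z. (U' has_real_derivative 3 * ((U z)\<^sup>2 - (V z)\<^sup>2) - U z) (at z)"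
    and V: "\<And>z. (V has_real_derivative V' z) (at z)"
    and V': "\<And>z. (V' has_real_derivative 6 * U z * V z - V z) (at z)"
  shows "coupled_kdv_solution (-1)
    (\<lambda>x t. - 6 * a\<^sup>2 * U (a * x + (a ^ 3 * t + c)))
    (\<lambda>x t. 6 * a\<^sup>2 * V (a * x + (a ^ 3 * t + c)))"
proof -
  define p where "p x t = a * x + (a ^ 3 * t + c)" for x t
  have px: "((\<lambda>y. p y t) has_real_derivative a) (at x)" for x t
    unfolding p_def by (auto intro!: derivative_eq_intros)
  have pt: "((\<lambda>s. p x s) has_real_derivative a ^ 3) (at t)" for x t
    unfolding p_def by (auto intro!: derivative_eq_intros)
  note chain = DERIV_chain2[OF U px] DERIV_chain2[OF U pt] DERIV_chain2[OF U' px]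
    DERIV_chain2[OF V px] DERIV_chain2[OF V pt] DERIV_chain2[OF V' px]
  show ?thesis
    unfolding coupled_kdv_solution_def p_def[symmetric]
    \<comment> \<open>Second derivatives are given by the right-hand sides of the profile equations,
      and third derivatives by differentiating these, so only \<open>U\<close>, \<open>V\<close>,
      \<open>U'\<close>, \<open>V'\<close> occur.\<close>
    apply (rule exI[of _ "\<lambda>x t. - 6 * a ^ 5 * U' (p x t)"])
    apply (rule exI[of _ "\<lambda>x t. - 6 * a ^ 3 * U' (p x t)"])
    apply (rule exI[of _ "\<lambda>x t. - 6 * a ^ 4 * (3 * ((U (p x t))\<^sup>2 - (V (p x t))\<^sup>2) - U (p x t))"])
    apply (rule exI[of _ "\<lambda>x t. - 6 * a ^ 5 * (6 * (U (p x t) * U' (p x t) - V (p x t) * V' (p x t)) - U' (p x t))"])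
    apply (rule exI[of _ "\<lambda>x t. 6 * a ^ 5 * V' (p x t)"])
    apply (rule exI[of _ "\<lambda>x t. 6 * a ^ 3 * V' (p x t)"])
    apply (rule exI[of _ "\<lambda>x t. 6 * a ^ 4 * (6 * U (p x t) * V (p x t) - V (p x t))"])
    apply (rule exI[of _ "\<lambda>x t. 6 * a ^ 5 * (6 * (U' (p x t) * V (p x t) + U (p x t) * V' (p x t)) - V' (p x t))"])
    by (intro allI conjI)
       ((rule derivative_eq_intros chain refl)+; simp add: algebra_simps power2_eq_square power_numeral_reduce | algebra)+
qed

text \<open>Everything rests on W' = e sin W^2. As \<open>U'\<close> and \<open>V\<close> are linear
  in sin, differentiating them yields only cos W and sin^2 W^2 besides powers of \<open>W\<close>,
  and both can be eliminated. This is how \<open>V'\<close> becomes a polynomial in \<open>W\<close>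
  alone.\<close>

lemma periodic_profile:
  fixes k m e :: real
  assumes k2: "k\<^sup>2 = 1 + m\<^sup>2" and e2: "e\<^sup>2 = 1" and D_nz: "\<And>z. e * cos z + k \<noteq> 0"
  defines "W \<equiv> \<lambda>z. 1 / (e * cos z + k)"
  defines "U \<equiv> \<lambda>z. k * W z - m\<^sup>2 * (W z)\<^sup>2"
    and "U' \<equiv> \<lambda>z. e * sin z * (k * (W z)\<^sup>2 - 2 * m\<^sup>2 * (W z) ^ 3)"
    and "V \<equiv> \<lambda>z. m * (e * sin z) * (W z)\<^sup>2"
    and "V' \<equiv> \<lambda>z. m * (3 * k * (W z)\<^sup>2 - W z - 2 * m\<^sup>2 * (W z) ^ 3)"
  shows "(U has_real_derivative U' z) (at z)"
    and "(U' has_real_derivative 3 * ((U z)\<^sup>2 - (V z)\<^sup>2) - U z) (at z)"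
    and "(V has_real_derivative V' z) (at z)"
    and "(V' has_real_derivative 6 * U z * V z - V z) (at z)"
proof -
  define S where "S z = e * sin z" for z
  have W: "(W has_real_derivative S z * (W z)\<^sup>2) (at z)" for z
    unfolding W_def S_def
    by (auto intro!: derivative_eq_intros simp: D_nz power2_eq_square)
  have S: "(S has_real_derivative e * cos z) (at z)" for z
    unfolding S_def by (auto intro!: derivative_eq_intros)
  have cosW: "e * cos z * W z = 1 - k * W z"
    using D_nz[of z] by (simp add: W_def divide_simps)
  have "(S z)\<^sup>2 + (e * cos z)\<^sup>2 = e\<^sup>2 * ((sin z)\<^sup>2 + (cos z)\<^sup>2)"
    unfolding S_def by (simp only: power_mult_distrib distrib_left)
  then have "(S z)\<^sup>2 * (W z)\<^sup>2 = (W z)\<^sup>2 - (e * cos z * W z)\<^sup>2"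
    using e2 by (simp only: sin_cos_squared_add) algebra
  \<comment> \<open>With e cos W = 1 - k W, the coefficient of W^2 is 1 - k^2 = -m^2.\<close>
  then have SW: "(S z)\<^sup>2 * (W z)\<^sup>2 = 2 * k * W z - 1 - m\<^sup>2 * (W z)\<^sup>2"
    using k2 cosW by algebra
  note defs = U_def U'_def V_def V'_def S_def[symmetric]
  show "(U has_real_derivative U' z) (at z)"
    unfolding defs
    by (rule derivative_eq_intros W refl)+ (simp, algebra)
  have eq: "e * cos z * (k * (W z)\<^sup>2 - 2 * m\<^sup>2 * (W z) ^ 3)
      + S z * (k * (2 * W z * (S z * (W z)\<^sup>2)) - 2 * m\<^sup>2 * (3 * (W z)\<^sup>2 * (S z * (W z)\<^sup>2)))
      = 3 * ((k * W z - m\<^sup>2 * (W z)\<^sup>2)\<^sup>2 - (m * S z * (W z)\<^sup>2)\<^sup>2) - (k * W z - m\<^sup>2 * (W z)\<^sup>2)"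
    using cosW SW k2 by algebra
  show "(U' has_real_derivative 3 * ((U z)\<^sup>2 - (V z)\<^sup>2) - U z) (at z)"
    unfolding defs
    by (rule derivative_eq_intros W S refl)+ (use eq in \<open>simp add: algebra_simps\<close>)
  have eq: "m * (e * cos z) * (W z)\<^sup>2 + m * S z * (2 * W z * (S z * (W z)\<^sup>2))
      = m * (3 * k * (W z)\<^sup>2 - W z - 2 * m\<^sup>2 * (W z) ^ 3)"
    using cosW SW by algebra
  show "(V has_real_derivative V' z) (at z)"
    unfolding defs
    by (rule derivative_eq_intros W S refl)+ (use eq in \<open>simp add: algebra_simps\<close>)
  \<comment> \<open>The derivative of the polynomial \<open>V'\<close> is m S W^2 (6 k W - 1 - 6 m^2
    W^2), which is V (6 U - 1).\<close>
  show "(V' has_real_derivative 6 * U z * V z - V z) (at z)"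
    unfolding defs
    by (rule derivative_eq_intros W refl)+ (simp, algebra)
qed

theorem proposition2:
  fixes \<eta> C \<rho> \<epsilon> \<delta> a A c\<^sub>0 :: real
    and b :: "real \<Rightarrow> real"
    and u v :: "real \<Rightarrow> real \<Rightarrow> real"
  assumes eta: "\<eta> < 0"
    and rho: "\<rho> \<noteq> 0"
    and delta_def: "\<delta> = 3/2 * (C\<^sup>2 / \<bar>\<eta>\<bar>) - (\<rho> / 12)\<^sup>2"
    and delta_pos: "\<delta> > 0"
    and C_pos: "C > 0"
    and eps: "\<epsilon> = 1 \<or> \<epsilon> = -1"
    and a_def: "a = 2 * sqrt (\<bar>\<eta>\<bar> / 6)"
    and A_def: "A = sqrt (6 * \<delta> / \<bar>\<eta>\<bar>)"
    and b_def: "\<And>t. b t = a^3 * t + c\<^sub>0"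
    and u_def: "\<And>x t. u x t =
        - 4 * \<bar>\<eta>\<bar> * (1 + 3 * C * \<epsilon> / (\<bar>\<eta>\<bar> * A) * cos (a * x + b t))
          / (\<epsilon> * cos (a * x + b t) + 3 * C / (\<bar>\<eta>\<bar> * A))\<^sup>2"
    and v_def: "\<And>x t. v x t =
        \<rho> * a / A * (\<epsilon> * sin (a * x + b t)
          / (\<epsilon> * cos (a * x + b t) + 3 * C / (\<bar>\<eta>\<bar> * A))\<^sup>2)"
  shows "coupled_kdv_solution (-1) u v"
proof -
  define k where "k = 3 * C / (\<bar>\<eta>\<bar> * A)"
  define m where "m = \<rho> / (6 * a * A)"
  define E where "E = \<bar>\<eta>\<bar>"
  have E: "E > 0" using eta by (simp add: E_def)
  have a: "a > 0" and a2: "a\<^sup>2 = 2 * E / 3"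
    using E by (simp_all add: a_def E_def[symmetric] power_mult_distrib)
  have A: "A > 0" and A2: "A\<^sup>2 = 6 * \<delta> / E"
    using E delta_pos by (simp_all add: A_def E_def[symmetric])
  have E\<rho>: "E * \<rho>\<^sup>2 = 216 * C\<^sup>2 - 144 * E * \<delta>"
    using E by (simp add: delta_def E_def[symmetric] field_simps)
  \<comment> \<open>Here a^2 A^2 = 4 \<delta>, so m^2 = \<rho>^2 / (144 \<delta>); the definition of
    \<delta> then turns 1 + m^2 into this same quotient.\<close>
  have "k\<^sup>2 = 3 * C\<^sup>2 / (2 * E * \<delta>)"
    unfolding k_def E_def[symmetric] power_divide power_mult_distrib A2
    using E by (simp add: power2_eq_square)
  also have "\<dots> = 1 + m\<^sup>2"
    unfolding m_def power_divide power_mult_distrib A2 a2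
    using E delta_pos E\<rho> by (simp add: divide_simps) algebra
  finally have k2: "k\<^sup>2 = 1 + m\<^sup>2" .
  have k_pos: "k > 0"
    using C_pos A E by (simp add: k_def E_def)
  \<comment> \<open>The condition \<rho> \<noteq> 0 makes k > 1 strict, which keeps the denominator
    away from zero for both signs of \<epsilon>.\<close>
  have "m \<noteq> 0"
    using rho a A by (simp add: m_def)
  then have "1\<^sup>2 < k\<^sup>2"
    using k2 by simp
  then have k1: "k > 1"
    using k_pos power2_less_imp_less by (smt (verit))
  have e2: "\<epsilon>\<^sup>2 = 1"
    using eps by auto
  have nz: "\<epsilon> * cos z + k \<noteq> 0" for z
  proof -
    have "\<epsilon> * cos z \<ge> - 1"
      using eps by auto
    then show ?thesis
      using k1 by simp
  qed
  have u: "u = (\<lambda>x t. - 6 * a\<^sup>2 * (k * (1 / (\<epsilon> * cos (a * x + (a ^ 3 * t + c\<^sub>0)) + k))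
      - m\<^sup>2 * (1 / (\<epsilon> * cos (a * x + (a ^ 3 * t + c\<^sub>0)) + k))\<^sup>2))"
  proof (intro ext)
    fix x t
    define z where "z = a * x + (a ^ 3 * t + c\<^sub>0)"
    \<comment> \<open>Writing the numerator in terms of the denominator D = \<epsilon> cos z + k
      makes its quotient by D^2 equal to k W - m^2 W^2 with W = 1 / D.\<close>
    have "1 + k * \<epsilon> * cos z = k * (\<epsilon> * cos z + k) - m\<^sup>2"
      using k2 by (simp add: algebra_simps power2_eq_square)
    moreover have "4 * \<bar>\<eta>\<bar> = 6 * a\<^sup>2"
      using a2 by (simp add: E_def)
    ultimately have "u x t = - (6 * a\<^sup>2) * (k * (\<epsilon> * cos z + k) - m\<^sup>2) / (\<epsilon> * cos z + k)\<^sup>2"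
      unfolding u_def b_def z_def k_def by (simp add: mult.commute mult.left_commute)
    also have "\<dots> = - 6 * a\<^sup>2 * (k * (1 / (\<epsilon> * cos z + k)) - m\<^sup>2 * (1 / (\<epsilon> * cos z + k))\<^sup>2)"
      using nz[of z] by (simp add: divide_simps power2_eq_square)
    finally show "u x t = - 6 * a\<^sup>2 * (k * (1 / (\<epsilon> * cos (a * x + (a ^ 3 * t + c\<^sub>0)) + k))
      - m\<^sup>2 * (1 / (\<epsilon> * cos (a * x + (a ^ 3 * t + c\<^sub>0)) + k))\<^sup>2)"
      unfolding z_def .
  qed
  have "\<rho> * a / A = 6 * a\<^sup>2 * m"
    using a A by (simp add: m_def power2_eq_square)
  then have v: "v = (\<lambda>x t. 6 * a\<^sup>2 * (m * (\<epsilon> * sin (a * x + (a ^ 3 * t + c\<^sub>0)))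
      * (1 / (\<epsilon> * cos (a * x + (a ^ 3 * t + c\<^sub>0)) + k))\<^sup>2))"
    unfolding v_def b_def k_def by (intro ext) (simp add: power_divide)
  show ?thesis
    unfolding u v by (rule coupled_kdv_travelling_wave[OF periodic_profile[OF k2 e2 nz]])
qed

end
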